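(* Let $\{\langle X_t,G_t\rangle\}_{t\ge 0}$, $G_t=(\mathbb{N},E,C_t)$, be a proper, monotone increasing, possibly adaptive random walk in changing environment on $\mathbb{N}$, where $E=\{\{j,j+1\}:j\ge 0\}$. Suppose that it is bounded from above by some connected recurrent weighted graph $G_\infty=(\mathbb{N},E,C_\infty)$ (that is, $C_t(e)\le C_\infty(e)$ for all $e\in E$ and all $t$, almost surely). Then the walk is recurrent, i.e. almost surely $X_t$ visits every vertex of $\mathbb{N}$ infinitely many times.
   Context: A random walk in changing environment (RWCE) on a graph $G=(V,E)$ is a stochastic process $\{\langle X_t,G_t\rangle\}_{t=0}^\infty$ where $X_t\in V$ and $G_t=(V,E,C_t)$ is the graph $G$ equipped with a (random) conductance function $C_t:E\to[0,\infty)$, with total conductance at each vertex finite, such that for all $t$ and $v$, $$\mathbb{P}(X_{t+1}=v\mid \langle X_0,G_0\rangle,\dots,\langle X_t,G_t\rangle)=\frac{C_t(X_t,v)}{\sum_{e\in E: X_t\in e}C_t(e)}.$$ The conductances $C_t$ may depend on the whole history of the process and on extra randomness; "possibly adaptive" means no restriction is placed on this dependence. The RWCE is proper if $0<C_t(e)<\infty$ for all $t$ and $e$. It is monotone increasing if $C_{t+1}\ge C_t$ (edgewise) almost surely for all $t$. Here $\mathbb{N}=\{0,1,2,\dots\}$. A fixed (deterministic) weighted graph is called recurrent if the usual weighted (reversible) random walk on it is recurrent; for $\mathbb{N}$ with positive conductances $C_\infty$ this means $\sum_{j\ge0}1/C_\infty(j,j+1)=\infty$. *)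

theory Defs
  imports "HOL-Probability.Probability"
begin

text \<open>
  A graph is given by its set \<open>E\<close> of edges, an edge being the set of its end points; the vertex
  set is the whole type, and loops are allowed. Conductances are functions on edges, and only their values on \<open>E\<close> matter.
\<close>

definition weighted_graph :: "'v set set \<Rightarrow> ('v set \<Rightarrow> real) \<Rightarrow> bool" where
  "weighted_graph E c \<longleftrightarrow>
     (\<forall>e\<in>E. (\<exists>u v. e = {u, v}) \<and> 0 \<le> c e) \<and> (\<forall>v. c summable_on {e \<in> E. v \<in> e})"

definition connected_weighted_graph :: "'v set set \<Rightarrow> ('v set \<Rightarrow> real) \<Rightarrow> bool" where
  "connected_weighted_graph E c \<longleftrightarrow>
     weighted_graph E c \<and> (\<forall>x y. (x, y) \<in> {(u, v). {u, v} \<in> E \<and> 0 < c {u, v}}\<^sup>*)"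

definition step_prob :: "'v set set \<Rightarrow> ('v set \<Rightarrow> real) \<Rightarrow> 'v \<Rightarrow> 'v \<Rightarrow> real" where
  "step_prob E c x y =
     (if {x, y} \<in> E then c {x, y} else 0) / (\<Sum>\<^sub>\<infinity>e\<in>{e \<in> E. x \<in> e}. c e)"

text \<open>
  The sigma-algebra generated by the pairs of \<open>X s\<close> and \<open>G s\<close> for \<open>s \<le> t\<close>, where \<open>G s\<close> is
  encoded by the restriction of its conductance function to \<open>E\<close>.
\<close>

definition history ::
  "'a measure \<Rightarrow> 'v set set \<Rightarrow> (nat \<Rightarrow> 'a \<Rightarrow> 'v) \<Rightarrow> (nat \<Rightarrow> 'a \<Rightarrow> 'v set \<Rightarrow> real) \<Rightarrow> nat \<Rightarrow> 'a measure"
where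
  "history M E X C t =
     vimage_algebra (space M)
       (\<lambda>\<omega>. \<lambda>s\<in>{..t}. (X s \<omega>, restrict (C s \<omega>) E))
       (\<Pi>\<^sub>M s\<in>{..t}. count_space UNIV \<Otimes>\<^sub>M (\<Pi>\<^sub>M e\<in>E. (borel :: real measure)))"

text \<open>
  The conductances may use randomness beyond the walk and be arbitrarily adaptive: the only
  probabilistic requirement is the conditional law of the next step given the history.
\<close>

locale rwce = prob_space M
  for M :: "'a measure"
    and E :: "('v::countable) set set"
    and X :: "nat \<Rightarrow> 'a \<Rightarrow> 'v"
    and C :: "nat \<Rightarrow> 'a \<Rightarrow> 'v set \<Rightarrow> real" +
  assumes measurable_walk: "X t \<in> measurable M (count_space UNIV)"
    and measurable_conductance: "e \<in> E \<Longrightarrow> (\<lambda>\<omega>. C t \<omega> e) \<in> borel_measurable M"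
    and weighted: "\<omega> \<in> space M \<Longrightarrow> weighted_graph E (C t \<omega>)"
    and step: "AE \<omega> in M. real_cond_exp M (history M E X C t)
        (indicator {\<omega> \<in> space M. X (Suc t) \<omega> = v}) \<omega> = step_prob E (C t \<omega>) (X t \<omega>) v"

definition proper ::
  "'a measure \<Rightarrow> 'v set set \<Rightarrow> (nat \<Rightarrow> 'a \<Rightarrow> 'v set \<Rightarrow> real) \<Rightarrow> bool" where
  "proper M E C \<longleftrightarrow> (AE \<omega> in M. \<forall>t. \<forall>e\<in>E. 0 < C t \<omega> e)"

definition monotone_increasing ::
  "'a measure \<Rightarrow> 'v set set \<Rightarrow> (nat \<Rightarrow> 'a \<Rightarrow> 'v set \<Rightarrow> real) \<Rightarrow> bool" where
  "monotone_increasing M E C \<longleftrightarrow> (\<forall>t. AE \<omega> in M. \<forall>e\<in>E. C t \<omega> e \<le> C (Suc t) \<omega> e)"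

definition bounded_above_by ::
  "'a measure \<Rightarrow> 'v set set \<Rightarrow> (nat \<Rightarrow> 'a \<Rightarrow> 'v set \<Rightarrow> real) \<Rightarrow> ('v set \<Rightarrow> real) \<Rightarrow> bool" where
  "bounded_above_by M E C c \<longleftrightarrow> (AE \<omega> in M. \<forall>t. \<forall>e\<in>E. C t \<omega> e \<le> c e)"

definition recurrent_walk :: "'a measure \<Rightarrow> (nat \<Rightarrow> 'a \<Rightarrow> 'v) \<Rightarrow> bool" where
  "recurrent_walk M X \<longleftrightarrow> (AE \<omega> in M. \<forall>v. infinite {t. X t \<omega> = v})"

text \<open>
  The weighted random walk is the coordinate process on path space with constant deterministic
  conductances. Its law \<open>P\<close> is determined by the starting vertex, so requiring some \<open>P\<close> to be
  recurrent loses nothing; a universal quantifier would be vacuous at vertices of zero total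
  conductance, where no such law exists.
\<close>

definition weighted_walk_law ::
  "('v::countable) set set \<Rightarrow> ('v set \<Rightarrow> real) \<Rightarrow> 'v \<Rightarrow> (nat \<Rightarrow> 'v) measure \<Rightarrow> bool" where
  "weighted_walk_law E c x P \<longleftrightarrow>
     sets P = sets (\<Pi>\<^sub>M t\<in>UNIV. count_space UNIV) \<and>
     rwce P E (\<lambda>t \<omega>. \<omega> t) (\<lambda>t \<omega>. c) \<and> (AE \<omega> in P. \<omega> 0 = x)"

definition recurrent_weighted_graph ::
  "('v::countable) set set \<Rightarrow> ('v set \<Rightarrow> real) \<Rightarrow> bool" where
  "recurrent_weighted_graph E c \<longleftrightarrow>
     (\<forall>x. \<exists>P. weighted_walk_law E c x P \<and> recurrent_walk P (\<lambda>t \<omega>. \<omega> t))"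

definition nat_edges :: "nat set set" where
  "nat_edges = {{j, Suc j} | j. True}"

end

theory Submission
  imports Defs
begin

text \<open>
  Let \<open>h\<^sub>t(n)\<close> be the effective resistance from \<open>0\<close> to \<open>n\<close> under the conductances \<open>C\<^sub>t\<close>. Away from \<open>0\<close>
  it is harmonic for the walk's next step, and raising conductances only lowers it, so \<open>h\<^sub>t(X\<^sub>t)\<close> is
  a nonnegative supermartingale until the walk hits \<open>0\<close>. Reaching \<open>N\<close> first costs at least the
  resistance of the bounding graph, so after any time the walk avoids \<open>0\<close> and reaches \<open>N\<close> with
  probability of order \<open>1 / h\<^sub>\<infinity>(N)\<close>, which tends to \<open>0\<close>. On the other hand, the walk cannot stay below
  \<open>N\<close> forever, because monotonicity and the upper bound keep the probabilities of a step to the right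
  away from \<open>0\<close> there. Hence the walk keeps hitting \<open>0\<close>, is unbounded, and moves by single steps.
\<close>

section \<open>The natural filtration and the one-step law\<close>

context rwce
begin

abbreviation hist :: "nat \<Rightarrow> 'a measure" where
  "hist t \<equiv> history M E X C t"

lemma history_map_measurable:
  "(\<lambda>\<omega>. \<lambda>s\<in>{..t}. (X s \<omega>, restrict (C s \<omega>) E)) \<in>
     measurable M (\<Pi>\<^sub>M s\<in>{..t}. count_space UNIV \<Otimes>\<^sub>M (\<Pi>\<^sub>M e\<in>E. (borel :: real measure)))"
  by (intro measurable_restrict measurable_Pair measurable_walk measurable_conductance)

lemma subalgebra_history: "subalgebra M (hist t)"
proof -
  have "sets (hist t) \<subseteq> sets M"
    using history_map_measurable[of t] unfolding measurable_iff_sets history_def by blast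
  then show ?thesis by (simp add: subalgebra_def history_def)
qed

sublocale history: finite_measure_subalgebra M "hist t" for t
  by unfold_locales (rule subalgebra_history)

lemma history_map_measurable_history:
  "(\<lambda>\<omega>. \<lambda>s\<in>{..t}. (X s \<omega>, restrict (C s \<omega>) E)) \<in>
     measurable (hist t) (\<Pi>\<^sub>M s\<in>{..t}. count_space UNIV \<Otimes>\<^sub>M (\<Pi>\<^sub>M e\<in>E. (borel :: real measure)))"
  unfolding history_def
  using history_map_measurable[of t, THEN measurable_space]
  by (intro measurable_vimage_algebra1) auto

lemma state_measurable_history:
  assumes "s \<le> t"
  shows "(\<lambda>\<omega>. (X s \<omega>, restrict (C s \<omega>) E)) \<in>
    measurable (hist t) (count_space UNIV \<Otimes>\<^sub>M (\<Pi>\<^sub>M e\<in>E. (borel :: real measure)))"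
  using measurable_compose[OF history_map_measurable_history measurable_component_singleton, of s t]
    assms by simp

lemma walk_measurable_history [measurable]:
  "s \<le> t \<Longrightarrow> X s \<in> measurable (hist t) (count_space UNIV)"
  using measurable_compose[OF state_measurable_history measurable_fst] by simp

lemma conductance_measurable_history [measurable]:
  assumes "s \<le> t" "e \<in> E"
  shows "(\<lambda>\<omega>. C s \<omega> e) \<in> borel_measurable (hist t)"
  using measurable_compose[OF measurable_compose[OF state_measurable_history measurable_snd]
      measurable_component_singleton, of s t e] assms by simp

lemma measurable_from_history: "f \<in> measurable (hist t) N \<Longrightarrow> f \<in> measurable M N"
  by (rule measurable_from_subalg[OF subalgebra_history])

declare measurable_walk [measurable] measurable_conductance [measurable]

text \<open>
  The nonnegative form of the step law applies to history-measurable integrands without any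
  integrability assumption, which matters because \<open>1 / C t\<close> need not be integrable.
\<close>

lemma nn_cond_exp_step:
  "AE \<omega> in M. nn_cond_exp M (hist t) (indicator {\<omega> \<in> space M. X (Suc t) \<omega> = v}) \<omega>
     = ennreal (step_prob E (C t \<omega>) (X t \<omega>) v)"
proof -
  let ?f = "indicator {\<omega> \<in> space M. X (Suc t) \<omega> = v} :: 'a \<Rightarrow> real"
  let ?g = "indicator {\<omega> \<in> space M. X (Suc t) \<omega> = v} :: 'a \<Rightarrow> ennreal"
  have g_meas: "?g \<in> borel_measurable M" by measurable
  have fg: "(\<lambda>\<omega>. ennreal (?f \<omega>)) = ?g" by (auto simp: indicator_def)
  have neg: "(\<lambda>\<omega>. ennreal (- ?f \<omega>)) = (\<lambda>_. 0)"
    by (auto simp: fun_eq_iff indicator_def ennreal_neg)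
  \<comment> \<open>\<open>enn2real\<close> sends \<open>top\<close> to 0, so the real-valued law
    determines the nonnegative conditional expectation only where the latter is finite. Comparison
    with the constant 1 supplies that finiteness.\<close>
  have "AE \<omega> in M. nn_cond_exp M (hist t) ?g \<omega> \<le> nn_cond_exp M (hist t) (\<lambda>_. 1) \<omega>"
    using g_meas by (intro history.nn_cond_exp_mono) (auto simp: indicator_def)
  moreover have "AE \<omega> in M. 1 = nn_cond_exp M (hist t) (\<lambda>_. 1) \<omega>"
    by (rule history.nn_cond_exp_F_meas) simp
  moreover have "AE \<omega> in M. 0 = nn_cond_exp M (hist t) (\<lambda>_. 0) \<omega>"
    by (rule history.nn_cond_exp_F_meas) simp
  ultimately show ?thesis
    using step[of t v]
  proof eventually_elim
    case (elim \<omega>)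
    have "enn2real (nn_cond_exp M (hist t) ?g \<omega>) = step_prob E (C t \<omega>) (X t \<omega>) v"
      using elim(3,4) unfolding real_cond_exp_def fg neg by (metis diff_zero enn2real_0)
    moreover have "nn_cond_exp M (hist t) ?g \<omega> < top"
      using elim(1,2) by (metis ennreal_one_less_top order_le_less_trans)
    ultimately show ?case by (metis ennreal_enn2real)
  qed
qed

lemma nn_integral_step:
  assumes "f \<in> borel_measurable (hist t)"
  shows "(\<integral>\<^sup>+ \<omega>. f \<omega> * indicator {\<omega> \<in> space M. X (Suc t) \<omega> = v} \<omega> \<partial>M)
    = (\<integral>\<^sup>+ \<omega>. f \<omega> * ennreal (step_prob E (C t \<omega>) (X t \<omega>) v) \<partial>M)"
proof -
  have "(\<integral>\<^sup>+ \<omega>. f \<omega> * indicator {\<omega> \<in> space M. X (Suc t) \<omega> = v} \<omega> \<partial>M) =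
    (\<integral>\<^sup>+ \<omega>. f \<omega> * nn_cond_exp M (hist t) (indicator {\<omega> \<in> space M. X (Suc t) \<omega> = v}) \<omega> \<partial>M)"
    by (intro history.nn_cond_exp_intg[symmetric] assms) measurable
  also have "\<dots> = (\<integral>\<^sup>+ \<omega>. f \<omega> * ennreal (step_prob E (C t \<omega>) (X t \<omega>) v) \<partial>M)"
    using nn_cond_exp_step[of t v] by (intro nn_integral_cong_AE) (auto elim: eventually_mono)
  finally show ?thesis .
qed

end

section \<open>Transition probabilities on the half-line\<close>

lemma nat_edge_mem [simp]: "{j, Suc j} \<in> nat_edges"
  unfolding nat_edges_def by auto

lemma nat_edge_iff: "{x, y} \<in> nat_edges \<longleftrightarrow> y = Suc x \<or> x = Suc y"
  unfolding nat_edges_def by (auto simp: doubleton_eq_iff)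

lemma nat_edges_at_0: "{e \<in> nat_edges. 0 \<in> e} = {{0, Suc 0}}"
  unfolding nat_edges_def by auto

lemma nat_edges_at_Suc: "{e \<in> nat_edges. Suc x \<in> e} = {{x, Suc x}, {Suc x, Suc (Suc x)}}"
  unfolding nat_edges_def by auto

text \<open>The quotient at 0 stays uncancelled because no positivity is assumed: if the conductance
  vanishes, the quotient is 0 by the convention for division.\<close>

lemma step_prob_nat:
  "step_prob nat_edges c 0 v = (if v = 1 then c {0, 1} / c {0, 1} else 0)"
  "step_prob nat_edges c (Suc x) v =
     (if v = x then c {x, Suc x} / (c {x, Suc x} + c {Suc x, Suc (Suc x)})
      else if v = Suc (Suc x) then c {Suc x, Suc (Suc x)} / (c {x, Suc x} + c {Suc x, Suc (Suc x)})
      else 0)"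
  unfolding step_prob_def nat_edges_at_0 nat_edges_at_Suc
  by (auto simp: nat_edge_iff insert_commute doubleton_eq_iff)

locale nat_rwce = rwce M nat_edges X C
  for M :: "'a measure" and X :: "nat \<Rightarrow> 'a \<Rightarrow> nat" and C :: "nat \<Rightarrow> 'a \<Rightarrow> nat set \<Rightarrow> real"
begin

lemma step_prob_measurable [measurable]:
  "(\<lambda>\<omega>. ennreal (step_prob nat_edges (C t \<omega>) (X t \<omega>) v)) \<in> borel_measurable M"
proof -
  \<comment> \<open>In \<open>step_prob\<close> the random vertex sits in the index set of an
    infinite sum. The case split leaves an explicit function of countably many measurable
    conductances.\<close>
  have "(\<lambda>\<omega>. case X t \<omega> of
      0 \<Rightarrow> if v = 1 then C t \<omega> {0, 1} / C t \<omega> {0, 1} else 0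
    | Suc x \<Rightarrow> (if v = x then C t \<omega> {x, Suc x} / (C t \<omega> {x, Suc x} + C t \<omega> {Suc x, Suc (Suc x)})
    else if v = Suc (Suc x) then C t \<omega> {Suc x, Suc (Suc x)} / (C t \<omega> {x, Suc x} + C t \<omega> {Suc x, Suc (Suc x)})
    else 0)) \<in> borel_measurable M"
    using nat_edge_mem[of 0] by measurable
  also have "?this \<longleftrightarrow> (\<lambda>\<omega>. step_prob nat_edges (C t \<omega>) (X t \<omega>) v) \<in> borel_measurable M"
    by (intro measurable_cong) (auto simp: step_prob_nat split: nat.split)
  finally show ?thesis by measurable
qed

text \<open>Splitting by the value of the next vertex leaves, for each \<open>v\<close>, a
  history-measurable factor to which the step law applies. The integrand may thus depend on both the
  past and the next vertex, as all later one-step computations require.\<close>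

lemma nn_integral_next:
  assumes g: "\<And>v. g v \<in> borel_measurable (hist t)"
  shows "(\<integral>\<^sup>+ \<omega>. g (X (Suc t) \<omega>) \<omega> \<partial>M)
    = (\<integral>\<^sup>+ \<omega>. (\<Sum>v. g v \<omega> * ennreal (step_prob nat_edges (C t \<omega>) (X t \<omega>) v)) \<partial>M)"
proof -
  have gM [measurable]: "g v \<in> borel_measurable M" for v
    by (rule measurable_from_history[OF g])
  have "(\<integral>\<^sup>+ \<omega>. g (X (Suc t) \<omega>) \<omega> \<partial>M) =
     (\<integral>\<^sup>+ \<omega>. (\<Sum>v. g v \<omega> * indicator {\<omega> \<in> space M. X (Suc t) \<omega> = v} \<omega>) \<partial>M)"
  proof (rule nn_integral_cong)
    fix \<omega> assume "\<omega> \<in> space M"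
    then show "g (X (Suc t) \<omega>) \<omega> = (\<Sum>v. g v \<omega> * indicator {\<omega> \<in> space M. X (Suc t) \<omega> = v} \<omega>)"
      by (subst suminf_finite[where N="{X (Suc t) \<omega>}"]) (auto simp: indicator_def)
  qed
  also have "\<dots> = (\<Sum>v. \<integral>\<^sup>+ \<omega>. g v \<omega> * indicator {\<omega> \<in> space M. X (Suc t) \<omega> = v} \<omega> \<partial>M)"
    by (intro nn_integral_suminf) measurable
  also have "\<dots> = (\<Sum>v. \<integral>\<^sup>+ \<omega>. g v \<omega> * ennreal (step_prob nat_edges (C t \<omega>) (X t \<omega>) v) \<partial>M)"
    by (simp only: nn_integral_step[OF g])
  also have "\<dots> = (\<integral>\<^sup>+ \<omega>. (\<Sum>v. g v \<omega> * ennreal (step_prob nat_edges (C t \<omega>) (X t \<omega>) v)) \<partial>M)"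
    by (intro nn_integral_suminf[symmetric] borel_measurable_times_ennreal step_prob_measurable gM)
  finally show ?thesis .
qed

end

section \<open>Effective resistance and its harmonicity\<close>

lemma suminf_step_prob_Suc:
  "(\<Sum>v. g v * ennreal (step_prob nat_edges c (Suc x) v)) =
    g x * ennreal (c {x, Suc x} / (c {x, Suc x} + c {Suc x, Suc (Suc x)})) +
    g (Suc (Suc x)) * ennreal (c {Suc x, Suc (Suc x)} / (c {x, Suc x} + c {Suc x, Suc (Suc x)}))"
  by (subst suminf_finite[where N="{x, Suc (Suc x)}"]) (auto simp: step_prob_nat)

text \<open>Resistances \<open>1 / c\<close> in series add up, so for positive \<open>c\<close> this
  is the effective resistance between 0 and \<open>n\<close>.\<close>

definition potential :: "(nat set \<Rightarrow> real) \<Rightarrow> nat \<Rightarrow> real" where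
  "potential c n = (\<Sum>j<n. 1 / c {j, Suc j})"

lemma potential_0 [simp]: "potential c 0 = 0"
  and potential_Suc [simp]: "potential c (Suc n) = potential c n + 1 / c {n, Suc n}"
  by (simp_all add: potential_def)

lemma potential_nonneg: "(\<And>j. 0 < c {j, Suc j}) \<Longrightarrow> 0 \<le> potential c n"
  unfolding potential_def by (intro sum_nonneg) (simp add: less_imp_le)

lemma potential_mono: "(\<And>j. 0 < c {j, Suc j}) \<Longrightarrow> m \<le> n \<Longrightarrow> potential c m \<le> potential c n"
  unfolding potential_def by (intro sum_mono2) (auto simp: less_imp_le)

text \<open>Rayleigh monotonicity, which on a path holds term by term.\<close>

lemma potential_antimono:
  "(\<And>j. 0 < c {j, Suc j}) \<Longrightarrow> (\<And>j. c {j, Suc j} \<le> d {j, Suc j}) \<Longrightarrow> potential d n \<le> potential c n"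
  unfolding potential_def by (intro sum_mono frac_le) auto

text \<open>From \<open>Suc x\<close> the potential drops by \<open>1 / a\<close> with weight
  \<open>a\<close> or rises by \<open>1 / b\<close> with weight \<open>b\<close>, so the mean change
  is 0. At 0 the only move is upward and harmonicity fails.\<close>

lemma potential_harmonic:
  assumes pos: "\<And>j. 0 < c {j, Suc j}"
  shows "(\<Sum>v. ennreal (potential c v) * ennreal (step_prob nat_edges c (Suc x) v))
    = ennreal (potential c (Suc x))"
proof -
  define a b p where "a = c {x, Suc x}" and "b = c {Suc x, Suc (Suc x)}" and "p = potential c x"
  have ab: "0 < a" "0 < b" "0 \<le> p"
    using pos potential_nonneg[of c, OF pos] by (auto simp: a_def b_def p_def)
  then have sum_pos: "0 < a + b" by simp
  have "(\<Sum>v. ennreal (potential c v) * ennreal (step_prob nat_edges c (Suc x) v)) =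
     ennreal p * ennreal (a / (a + b)) + ennreal (p + 1 / a + 1 / b) * ennreal (b / (a + b))"
    unfolding suminf_step_prob_Suc by (simp add: a_def b_def p_def)
  also have "\<dots> = ennreal (p * (a / (a + b)) + (p + 1 / a + 1 / b) * (b / (a + b)))"
    using ab by (simp flip: ennreal_mult ennreal_plus)
  also have "p * (a / (a + b)) + (p + 1 / a + 1 / b) * (b / (a + b)) = p + 1 / a"
    using ab sum_pos by (simp add: divide_simps) (simp add: algebra_simps)
  finally show ?thesis by (simp add: a_def p_def)
qed

section \<open>Almost sure properties of the bounded walk\<close>

locale bounded_rwce = nat_rwce M X C
  for M :: "'a measure" and X :: "nat \<Rightarrow> 'a \<Rightarrow> nat" and C :: "nat \<Rightarrow> 'a \<Rightarrow> nat set \<Rightarrow> real" +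
  fixes c :: "nat set \<Rightarrow> real"
  assumes is_proper: "proper M nat_edges C"
    and is_monotone: "monotone_increasing M nat_edges C"
    and is_bounded: "bounded_above_by M nat_edges C c"
begin

lemma AE_pos: "AE \<omega> in M. \<forall>t j. 0 < C t \<omega> {j, Suc j}"
  using is_proper unfolding proper_def by eventually_elim simp

lemma AE_Suc_mono: "AE \<omega> in M. \<forall>t j. C t \<omega> {j, Suc j} \<le> C (Suc t) \<omega> {j, Suc j}"
proof -
  have "AE \<omega> in M. \<forall>t. \<forall>e\<in>nat_edges. C t \<omega> e \<le> C (Suc t) \<omega> e"
    using is_monotone unfolding monotone_increasing_def by (simp add: AE_all_countable)
  then show ?thesis by eventually_elim simp
qed

lemma AE_bounded: "AE \<omega> in M. \<forall>t j. C t \<omega> {j, Suc j} \<le> c {j, Suc j}"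
  using is_bounded unfolding bounded_above_by_def by eventually_elim simp

text \<open>\<open>c\<close> is deterministic, so its positivity, once almost sure on a probability
  space, holds outright.\<close>

lemma bound_pos: "0 < c {j, Suc j}"
proof -
  have "AE \<omega> in M. 0 < c {j, Suc j}"
    using AE_pos AE_bounded by eventually_elim (meson less_le_trans)
  then show ?thesis by simp
qed

text \<open>The indicator \<open>g\<close> of a jump to a non-neighbour vanishes wherever the
  transition probability does not, so its expectation at the next vertex is 0.\<close>

lemma AE_nearest_neighbour:
  "AE \<omega> in M. \<forall>t. X (Suc t) \<omega> = Suc (X t \<omega>) \<or> X t \<omega> = Suc (X (Suc t) \<omega>)"
  unfolding AE_all_countable
proof
  fix t
  define g :: "nat \<Rightarrow> 'a \<Rightarrow> ennreal" where "g v \<omega> = of_bool (v \<noteq> Suc (X t \<omega>) \<and> X t \<omega> \<noteq> Suc v)" for v \<omega>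
  have g: "g v \<in> borel_measurable (hist t)" for v
    unfolding g_def by measurable
  have gM [measurable]: "g v \<in> borel_measurable M" for v
    by (rule measurable_from_history[OF g])
  have gX: "(\<lambda>\<omega>. g (X (Suc t) \<omega>) \<omega>) \<in> borel_measurable M"
    by (rule measurable_compose_countable[OF gM measurable_walk])
  have "(\<integral>\<^sup>+ \<omega>. g (X (Suc t) \<omega>) \<omega> \<partial>M) =
      (\<integral>\<^sup>+ \<omega>. (\<Sum>v. g v \<omega> * ennreal (step_prob nat_edges (C t \<omega>) (X t \<omega>) v)) \<partial>M)"
    by (rule nn_integral_next[OF g])
  also have "\<dots> = (\<integral>\<^sup>+ \<omega>. 0 \<partial>M)"
  proof (rule nn_integral_cong)
    fix \<omega>
    have "g v \<omega> * ennreal (step_prob nat_edges (C t \<omega>) (X t \<omega>) v) = 0" for v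
      by (cases "X t \<omega>") (auto simp: step_prob_nat g_def)
    then show "(\<Sum>v. g v \<omega> * ennreal (step_prob nat_edges (C t \<omega>) (X t \<omega>) v)) = 0"
      by (simp only: suminf_zero)
  qed
  finally have "AE \<omega> in M. g (X (Suc t) \<omega>) \<omega> = 0"
    using gX by (simp add: nn_integral_0_iff_AE)
  then show "AE \<omega> in M. X (Suc t) \<omega> = Suc (X t \<omega>) \<or> X t \<omega> = Suc (X (Suc t) \<omega>)"
    by eventually_elim (auto simp: g_def split: if_splits)
qed

section \<open>The resistance supermartingale and its maximal inequality\<close>

lemma pred_walk_history: "Measurable.pred (hist t) (\<lambda>\<omega>. \<forall>u\<in>{s..t}. Q (X u \<omega>))"
proof (rule pred_intros_finite)
  fix u assume "u \<in> {s..t}"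
  then show "Measurable.pred (hist t) (\<lambda>\<omega>. Q (X u \<omega>))"
    using measurable_compose[OF walk_measurable_history[of u t], of Q] by simp
qed simp

lemma space_history [simp]: "space (hist t) = space M"
  by (simp add: history_def)

lemma potential_measurable_history [measurable]:
  assumes "s \<le> t"
  shows "(\<lambda>\<omega>. potential (C s \<omega>) n) \<in> borel_measurable (hist t)"
  unfolding potential_def using assms by measurable

lemma potential_walk_measurable_history [measurable]:
  assumes "s \<le> t" "u \<le> t"
  shows "(\<lambda>\<omega>. potential (C s \<omega>) (X u \<omega>)) \<in> borel_measurable (hist t)"
  using assms by (intro measurable_compose_countable[OF potential_measurable_history walk_measurable_history])

lemma potential_measurable [measurable]: "(\<lambda>\<omega>. potential (C s \<omega>) n) \<in> borel_measurable M"
  by (rule measurable_from_history[OF potential_measurable_history]) (rule order_refl)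

lemma potential_walk_measurable [measurable]:
  "(\<lambda>\<omega>. potential (C s \<omega>) (X u \<omega>)) \<in> borel_measurable M"
  by (intro measurable_compose_countable[OF potential_measurable measurable_walk])

text \<open>Only the walk moves while the conductances stay those of time \<open>t\<close>, which
  gives an exact martingale identity away from 0. Passing to \<open>C (Suc t)\<close> is a separate
  pointwise comparison.\<close>

lemma nn_integral_potential_next:
  assumes D: "D \<in> sets (hist t)" and nz: "\<And>\<omega>. \<omega> \<in> D \<Longrightarrow> X t \<omega> \<noteq> 0"
  shows "(\<integral>\<^sup>+ \<omega>. indicator D \<omega> * ennreal (potential (C t \<omega>) (X (Suc t) \<omega>)) \<partial>M) =
    (\<integral>\<^sup>+ \<omega>. indicator D \<omega> * ennreal (potential (C t \<omega>) (X t \<omega>)) \<partial>M)"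
proof -
  note D [measurable]
  have "(\<integral>\<^sup>+ \<omega>. indicator D \<omega> * ennreal (potential (C t \<omega>) (X (Suc t) \<omega>)) \<partial>M) =
    (\<integral>\<^sup>+ \<omega>. (\<Sum>v. (indicator D \<omega> * ennreal (potential (C t \<omega>) v)) *
        ennreal (step_prob nat_edges (C t \<omega>) (X t \<omega>) v)) \<partial>M)"
    by (rule nn_integral_next[where g="\<lambda>v \<omega>. indicator D \<omega> * ennreal (potential (C t \<omega>) v)"]) measurable
  also have "\<dots> = (\<integral>\<^sup>+ \<omega>. indicator D \<omega> * ennreal (potential (C t \<omega>) (X t \<omega>)) \<partial>M)"
  proof (rule nn_integral_cong_AE, use AE_pos in eventually_elim)
    case (elim \<omega>)
    show ?case
    proof (cases "\<omega> \<in> D")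
      case True
      then obtain x where x: "X t \<omega> = Suc x" using nz not0_implies_Suc by blast
      then show ?thesis using True elim potential_harmonic[of "C t \<omega>" x] by simp
    qed simp
  qed
  finally show ?thesis .
qed

text \<open>
  Maximal inequality for the supermartingale, killed at \<open>0\<close> and stopped at level \<open>N\<close>, where its
  value is at least \<open>potential c N\<close>.
\<close>

lemma hitting_bound:
  fixes s N :: nat and k :: real
  assumes "s \<le> t" "0 \<le> k"
  shows "ennreal (potential c N) * emeasure M {\<omega>\<in>space M. potential (C s \<omega>) (X s \<omega>) \<le> k \<and>
    (\<exists>u\<in>{s..t}. N \<le> X u \<omega> \<and> (\<forall>r\<in>{s..u}. X r \<omega> \<noteq> 0))} \<le> ennreal k"
proof -
  \<comment> \<open>\<open>D\<close> collects the paths still running and \<open>W\<close> those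
    absorbed at level \<open>N\<close>; paths that hit 0 first are in neither. The cutoff
    \<open>k\<close> at time \<open>s\<close> takes the place of integrability of the starting
    potential.\<close>
  define D where "D t = {\<omega>\<in>space M. potential (C s \<omega>) (X s \<omega>) \<le> k \<and>
    (\<forall>u\<in>{s..t}. X u \<omega> \<noteq> 0 \<and> X u \<omega> < N)}" for t
  define W where "W t = {\<omega>\<in>space M. potential (C s \<omega>) (X s \<omega>) \<le> k \<and>
    (\<exists>u\<in>{s..t}. N \<le> X u \<omega> \<and> (\<forall>r\<in>{s..u}. X r \<omega> \<noteq> 0))}" for t
  have D_hist: "D t \<in> sets (hist t)" if "s \<le> t" for t
  proof -
    have "Measurable.pred (hist t) (\<lambda>\<omega>. potential (C s \<omega>) (X s \<omega>) \<le> k)"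
      using borel_measurable_le[OF potential_walk_measurable_history borel_measurable_const] that
      by (simp add: pred_def)
    from pred_intros_logic(3)[OF this pred_walk_history[of s t "\<lambda>x. x \<noteq> 0 \<and> x < N"]] show ?thesis by (simp add: D_def pred_def)
  qed
  have [measurable]: "D t \<in> sets M" "W t \<in> sets M" for t
    unfolding D_def W_def by measurable
  have W_not_D: "\<omega> \<notin> D t'" if "\<omega> \<in> W t" "t \<le> t'" for \<omega> t t'
  proof -
    from that(1) obtain u where "u \<in> {s..t}" "N \<le> X u \<omega>" unfolding W_def by blast
    with that(2) have "u \<in> {s..t'}" "\<not> X u \<omega> < N" by auto
    then show ?thesis unfolding D_def by blast
  qed
  \<comment> \<open>Absorbed paths retain only the deterministic value \<open>potential c N\<close>,
    which bounds their potential at absorption from below, so this replacement can only decrease the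
    mean.\<close>
  define \<Phi> where "\<Phi> t = (\<integral>\<^sup>+ \<omega>. indicator (D t) \<omega> * ennreal (potential (C t \<omega>) (X t \<omega>))
      + ennreal (potential c N) * indicator (W t) \<omega> \<partial>M)" for t
  have "\<Phi> t \<le> ennreal k"
    using \<open>s \<le> t\<close>
  proof (induction rule: dec_induct)
    case base
    have "\<Phi> s \<le> (\<integral>\<^sup>+ \<omega>. ennreal k \<partial>M)"
      unfolding \<Phi>_def
    proof (rule nn_integral_mono_AE, use AE_pos AE_bounded in eventually_elim)
      case (elim \<omega>)
      have "potential c N \<le> potential (C s \<omega>) N"
        using elim by (intro potential_antimono) auto
      also have "potential (C s \<omega>) N \<le> potential (C s \<omega>) (X s \<omega>)" if "N \<le> X s \<omega>"
        using elim that by (intro potential_mono) auto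
      finally show ?case
        by (auto simp: D_def W_def indicator_def intro!: ennreal_leI)
    qed
    also have "\<dots> = ennreal k" by (simp add: emeasure_space_1)
    finally show ?case .
  next
    case (step t)
    have "\<Phi> (Suc t) \<le> (\<integral>\<^sup>+ \<omega>. indicator (D t) \<omega> * ennreal (potential (C t \<omega>) (X (Suc t) \<omega>))
        + ennreal (potential c N) * indicator (W t) \<omega> \<partial>M)"
      unfolding \<Phi>_def
    proof (rule nn_integral_mono_AE, use AE_pos AE_bounded AE_Suc_mono in eventually_elim)
      case (elim \<omega>)
      \<comment> \<open>The cases are: absorbed earlier, absorbed in this step, still running, and
        neither, where the left side is 0.\<close>
      consider "\<omega> \<in> W t" | "\<omega> \<notin> W t" "\<omega> \<in> W (Suc t)" | "\<omega> \<notin> W (Suc t)" "\<omega> \<in> D (Suc t)"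
        | "\<omega> \<notin> W (Suc t)" "\<omega> \<notin> D (Suc t)" by blast
      then show ?case
      proof cases
        case 1
        then have "\<omega> \<notin> D (Suc t)" by (rule W_not_D) simp
        moreover from 1 have "\<omega> \<in> W (Suc t)" by (fastforce simp: W_def)
        ultimately show ?thesis using 1 by simp
      next
        case 2
        then have "\<omega> \<notin> D (Suc t)" by (intro W_not_D[of _ "Suc t"]) auto
        from 2(2) obtain u where u: "u \<in> {s..Suc t}" "N \<le> X u \<omega>" "\<forall>r\<in>{s..u}. X r \<omega> \<noteq> 0"
          and "\<omega> \<in> space M" "potential (C s \<omega>) (X s \<omega>) \<le> k" by (auto simp: W_def)
        with 2(1) have "u = Suc t" by (force simp: W_def le_Suc_eq)
        with u have N: "N \<le> X (Suc t) \<omega>" and nz: "\<forall>r\<in>{s..t}. X r \<omega> \<noteq> 0" by auto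
        have "X r \<omega> < N" if "r \<in> {s..t}" for r
          using 2(1) nz that \<open>\<omega> \<in> space M\<close> \<open>potential (C s \<omega>) (X s \<omega>) \<le> k\<close>
          by (force simp: W_def not_less)
        with nz have "\<omega> \<in> D t"
          using \<open>\<omega> \<in> space M\<close> \<open>potential (C s \<omega>) (X s \<omega>) \<le> k\<close> by (auto simp: D_def)
        have "potential c N \<le> potential (C t \<omega>) N"
          using elim by (intro potential_antimono) auto
        also have "potential (C t \<omega>) N \<le> potential (C t \<omega>) (X (Suc t) \<omega>)"
          using elim N by (intro potential_mono) auto
        finally show ?thesis
          using \<open>\<omega> \<in> D t\<close> \<open>\<omega> \<notin> D (Suc t)\<close> 2 by (simp add: ennreal_leI)
      next
        case 3
        then have "\<omega> \<in> D t" by (auto simp: D_def)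
        moreover have "potential (C (Suc t) \<omega>) (X (Suc t) \<omega>) \<le> potential (C t \<omega>) (X (Suc t) \<omega>)"
          using elim by (intro potential_antimono) auto
        ultimately show ?thesis using 3 by (simp add: ennreal_leI add_increasing2)
      qed simp
    qed
    also have "\<dots> = \<Phi> t"
      unfolding \<Phi>_def using nn_integral_potential_next[OF D_hist[OF step(1)]] step(1)
      by (subst (1 2) nn_integral_add) (auto simp: D_def)
    finally show ?case using step by simp
  qed
  moreover have "ennreal (potential c N) * emeasure M (W t) \<le> \<Phi> t"
  proof -
    have "ennreal (potential c N) * emeasure M (W t)
      = (\<integral>\<^sup>+ \<omega>. ennreal (potential c N) * indicator (W t) \<omega> \<partial>M)"
      by (subst nn_integral_cmult_indicator) auto
    also have "\<dots> \<le> \<Phi> t" unfolding \<Phi>_def by (intro nn_integral_mono) simp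
    finally show ?thesis .
  qed
  ultimately show ?thesis unfolding W_def by (rule order_trans[rotated])
qed

end

section \<open>Escape from finite intervals\<close>

context bounded_rwce
begin

lemma AE_mono: "AE \<omega> in M. \<forall>s t j. s \<le> t \<longrightarrow> C s \<omega> {j, Suc j} \<le> C t \<omega> {j, Suc j}"
  using AE_Suc_mono
proof eventually_elim
  case (elim \<omega>)
  then show ?case
    using lift_Suc_mono_le[of "\<lambda>t. C t \<omega> {j, Suc j}" for j] by blast
qed

text \<open>
  The process equal to \<open>K ^ X t\<close> while the walk is confined to \<open>{..n}\<close>, and frozen at \<open>K ^ Suc n\<close>
  afterwards, is bounded, but for large \<open>K\<close> its mean grows in each step by at least the
  probability of still being confined.
\<close>

lemma confined_null:
  fixes s n :: nat and \<epsilon> :: real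
  assumes \<epsilon>: "0 < \<epsilon>"
  shows "AE \<omega> in M. \<not> ((\<forall>j\<le>n. \<epsilon> \<le> C s \<omega> {j, Suc j}) \<and> (\<forall>u\<ge>s. X u \<omega> \<le> n))"
proof -
  define D where "D t = {\<omega>\<in>space M. (\<forall>j\<le>n. \<epsilon> \<le> C s \<omega> {j, Suc j}) \<and> (\<forall>u\<in>{s..t}. X u \<omega> \<le> n)}" for t
  define D' where "D' = {\<omega>\<in>space M. (\<forall>j\<le>n. \<epsilon> \<le> C s \<omega> {j, Suc j}) \<and> (\<forall>u\<ge>s. X u \<omega> \<le> n)}"
  have D_hist: "D t \<in> sets (hist t)" if "s \<le> t" for t
  proof -
    have "Measurable.pred (hist t) (\<lambda>\<omega>. \<forall>j\<in>{..n}. \<epsilon> \<le> C s \<omega> {j, Suc j})"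
    proof (rule pred_intros_finite)
      fix j
      show "Measurable.pred (hist t) (\<lambda>\<omega>. \<epsilon> \<le> C s \<omega> {j, Suc j})"
        using borel_measurable_le[OF borel_measurable_const conductance_measurable_history[OF that nat_edge_mem]]
        by (simp add: pred_def)
    qed simp
    from pred_intros_logic(3)[OF this pred_walk_history[of s t "\<lambda>x. x \<le> n"]]
    have "{\<omega>\<in>space M. (\<forall>j\<in>{..n}. \<epsilon> \<le> C s \<omega> {j, Suc j}) \<and> (\<forall>u\<in>{s..t}. X u \<omega> \<le> n)} \<in> sets (hist t)"
      unfolding pred_def space_history .
    then show ?thesis unfolding D_def Ball_def atMost_iff .
  qed
  have [measurable]: "D' \<in> sets M"
    unfolding D'_def by measurable
  have [measurable]: "D t \<in> sets M" for t
    unfolding D_def by measurable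
  define b where "b = (\<Sum>j\<le>n. c {j, Suc j})"
  have b_bound: "c {j, Suc j} \<le> b" if "j \<le> n" for j
    unfolding b_def using that bound_pos by (intro member_le_sum) (auto simp: less_imp_le)
  have b_pos: "0 < b" using b_bound[of 0] bound_pos[of 0] by simp
  \<comment> \<open>While confined, the walk steps right with probability at least
    \<open>\<epsilon> / (2 * b)\<close> from a positive vertex and surely from 0. This
    \<open>K\<close> makes that probability times \<open>K\<close> at least 2, and
    \<open>2 * K ^ X t\<close> exceeds \<open>K ^ X t\<close> by at least 1.\<close>
  define K where "K = 2 + 4 * b / \<epsilon>"
  have K: "2 \<le> K" using b_pos \<epsilon> by (simp add: K_def)
  define \<Phi> where "\<Phi> t = (\<integral>\<^sup>+ \<omega>. ennreal (if \<omega> \<in> D t then K ^ X t \<omega> else K ^ Suc n) \<partial>M)" for t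
  have drift: "\<Phi> t + emeasure M (D t) \<le> \<Phi> (Suc t)" if "s \<le> t" for t
  proof -
    \<comment> \<open>Only steps to the right are kept; a step to the left contributes a nonnegative
      amount that the lower bound drops.\<close>
    define g where "g v \<omega> = indicator (D t) \<omega> * (if v = Suc (X t \<omega>) then ennreal (K ^ v) else 0)" for v \<omega>
    have g: "g v \<in> borel_measurable (hist t)" for v
    proof -
      note D_hist[OF that, measurable]
      show ?thesis unfolding g_def by measurable
    qed
    have gM [measurable]: "g v \<in> borel_measurable M" for v
      by (rule measurable_from_history[OF g])
    have [measurable]: "(\<lambda>\<omega>. g (X (Suc t) \<omega>) \<omega>) \<in> borel_measurable M"
      by (rule measurable_compose_countable[OF gM measurable_walk])
    have "\<Phi> t + emeasure M (D t) =
      (\<integral>\<^sup>+ \<omega>. ennreal (if \<omega> \<in> D t then K ^ X t \<omega> else K ^ Suc n) + indicator (D t) \<omega> \<partial>M)"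
      unfolding \<Phi>_def by (subst nn_integral_add) auto
    also have "\<dots> \<le> (\<integral>\<^sup>+ \<omega>. (\<Sum>v. g v \<omega> * ennreal (step_prob nat_edges (C t \<omega>) (X t \<omega>) v))
        + ennreal (K ^ Suc n) * indicator (space M - D t) \<omega> \<partial>M)"
    proof (rule nn_integral_mono_AE, use AE_pos AE_bounded AE_mono AE_space in eventually_elim)
      case (elim \<omega>)
      show ?case
      proof (cases "\<omega> \<in> D t")
        case True
        define p where "p = step_prob nat_edges (C t \<omega>) (X t \<omega>) (Suc (X t \<omega>))"
        have Xn: "X t \<omega> \<le> n" and "\<epsilon> \<le> C s \<omega> {X t \<omega>, Suc (X t \<omega>)}" "\<omega> \<in> space M"
          using True that by (auto simp: D_def)
        \<comment> \<open>Monotonicity carries the lower bound from time \<open>s\<close> to time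
          \<open>t\<close>.\<close>
        then have C_low: "\<epsilon> \<le> C t \<omega> {X t \<omega>, Suc (X t \<omega>)}"
          using elim that order_trans by blast
        have C_up: "C t \<omega> {j, Suc j} \<le> b" if "j \<le> n" for j
          using elim b_bound[OF that] order_trans by blast
        have "2 \<le> p * K"
        proof (cases "X t \<omega>")
          case 0
          then show ?thesis using elim(1)[rule_format, of t 0] K by (simp add: p_def step_prob_nat)
        next
          case (Suc x)
          define l r where "l = C t \<omega> {x, Suc x}" and "r = C t \<omega> {Suc x, Suc (Suc x)}"
          have lr: "0 < l" "l \<le> b" "\<epsilon> \<le> r" "r \<le> b"
            using elim C_low C_up Suc Xn by (auto simp: l_def r_def)
          then have "\<epsilon> / (2 * b) \<le> r / (l + r)" using \<epsilon> by (intro frac_le) auto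
          then have "\<epsilon> / (2 * b) * K \<le> p * K"
            using K by (intro mult_right_mono) (auto simp: p_def Suc step_prob_nat l_def r_def)
          moreover have "2 \<le> \<epsilon> / (2 * b) * K"
            using b_pos \<epsilon> by (simp add: K_def field_simps)
          ultimately show ?thesis by simp
        qed
        then have p: "0 \<le> p" using K zero_less_mult_iff[of p K] by auto
        have "K ^ X t \<omega> + 1 \<le> 2 * K ^ X t \<omega>" using K by simp
        also have "\<dots> \<le> (p * K) * K ^ X t \<omega>"
          using \<open>2 \<le> p * K\<close> K by (intro mult_right_mono) auto
        finally have *: "ennreal (K ^ X t \<omega> + 1) \<le> ennreal (K ^ Suc (X t \<omega>) * p)"
          by (intro ennreal_leI) (simp add: mult_ac)
        have "ennreal (K ^ X t \<omega>) + 1 = ennreal (K ^ X t \<omega> + 1)"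
          using K by (subst ennreal_plus) auto
        also note *
        also have "ennreal (K ^ Suc (X t \<omega>) * p) = ennreal (K ^ Suc (X t \<omega>)) * ennreal p"
          using K p by (intro ennreal_mult) auto
        also have "\<dots> = (\<Sum>v. g v \<omega> * ennreal (step_prob nat_edges (C t \<omega>) (X t \<omega>) v))"
          using True by (subst suminf_finite[where N="{Suc (X t \<omega>)}"]) (auto simp: g_def p_def)
        finally show ?thesis using True by simp
      next
        case False
        with elim show ?thesis by simp
      qed
    qed
    also have "\<dots> = (\<integral>\<^sup>+ \<omega>. g (X (Suc t) \<omega>) \<omega> + ennreal (K ^ Suc n) * indicator (space M - D t) \<omega> \<partial>M)"
      using nn_integral_next[of g t] g by (subst (1 2) nn_integral_add) auto
    also have "\<dots> \<le> \<Phi> (Suc t)"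
      unfolding \<Phi>_def
    proof (rule nn_integral_mono)
      fix \<omega> assume "\<omega> \<in> space M"
      show "g (X (Suc t) \<omega>) \<omega> + ennreal (K ^ Suc n) * indicator (space M - D t) \<omega> \<le>
        ennreal (if \<omega> \<in> D (Suc t) then K ^ X (Suc t) \<omega> else K ^ Suc n)"
      proof (cases "\<omega> \<in> D t")
        case True
        then have "X t \<omega> \<le> n" using that by (auto simp: D_def)
        then have "K ^ Suc (X t \<omega>) \<le> K ^ Suc n" using K by (intro power_increasing) auto
        then show ?thesis using True by (auto simp: g_def intro: ennreal_leI)
      next
        case False
        then have "\<omega> \<notin> D (Suc t)" by (auto simp: D_def)
        with False show ?thesis by (auto simp: g_def indicator_def)
      qed
    qed
    finally show ?thesis .
  qed
  \<comment> \<open>\<open>D'\<close> lies in every \<open>D t\<close>, so each step adds at least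
    its probability. Linear growth against the uniform bound \<open>upper\<close> forces that
    probability to be 0.\<close>
  have lower: "of_nat m * emeasure M D' \<le> \<Phi> (s + m)" for m
  proof (induction m)
    case (Suc m)
    have "of_nat (Suc m) * emeasure M D' = of_nat m * emeasure M D' + emeasure M D'"
      by (simp add: algebra_simps)
    also have "\<dots> \<le> \<Phi> (s + m) + emeasure M (D (s + m))"
      by (intro add_mono Suc emeasure_mono) (auto simp: D_def D'_def)
    also have "\<dots> \<le> \<Phi> (s + Suc m)" using drift[of "s + m"] by simp
    finally show ?case .
  qed simp
  have upper: "\<Phi> t \<le> ennreal (K ^ Suc n)" if "s \<le> t" for t
  proof -
    have "\<Phi> t \<le> (\<integral>\<^sup>+ \<omega>. ennreal (K ^ Suc n) \<partial>M)"
      unfolding \<Phi>_def using K that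
      by (intro nn_integral_mono ennreal_leI) (auto simp: D_def simp del: power_Suc intro!: power_increasing le_SucI)
    then show ?thesis by (simp add: emeasure_space_1)
  qed
  have bounded: "real m * measure M D' \<le> K ^ Suc n" for m
  proof -
    have "ennreal (real m * measure M D') \<le> ennreal (K ^ Suc n)"
      using order_trans[OF lower upper[of "s + m"]]
      by (simp add: emeasure_eq_measure ennreal_mult ennreal_of_nat_eq_real_of_nat)
    then show ?thesis using K by (subst (asm) ennreal_le_iff) auto
  qed
  have "measure M D' = 0"
  proof (rule ccontr)
    assume "measure M D' \<noteq> 0"
    then have "0 < measure M D'" by (simp add: zero_less_measure_iff)
    then obtain m where "K ^ Suc n < real m * measure M D'"
      using reals_Archimedean3 by blast
    with bounded[of m] show False by simp
  qed
  then have "D' \<in> null_sets M"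
    by (simp add: null_sets_def emeasure_eq_measure)
  from AE_not_in[OF this] AE_space show ?thesis
    by eventually_elim (auto simp: D'_def)
qed

text \<open>At time \<open>s\<close> the finitely many conductances up to \<open>n\<close> have a
  positive, random minimum. Letting the deterministic bound run through
  \<open>inverse (Suc m)\<close> covers it with countably many null events.\<close>

lemma AE_unbounded: "AE \<omega> in M. \<forall>s n. \<exists>u\<ge>s. n < X u \<omega>"
proof -
  have "AE \<omega> in M. \<forall>s n m. \<not> ((\<forall>j\<le>n. inverse (real (Suc m)) \<le> C s \<omega> {j, Suc j}) \<and> (\<forall>u\<ge>s. X u \<omega> \<le> n))"
    by (intro AE_all_countable[THEN iffD2] allI confined_null) simp
  then show ?thesis
    using AE_pos
  proof eventually_elim
    case (elim \<omega>)
    show ?case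
    proof (intro allI)
      fix s n
      have "0 < Min ((\<lambda>j. C s \<omega> {j, Suc j}) ` {..n})" using elim(2) by simp
      then obtain m where m: "inverse (real (Suc m)) < Min ((\<lambda>j. C s \<omega> {j, Suc j}) ` {..n})"
        using reals_Archimedean by blast
      then have "\<forall>j\<le>n. inverse (real (Suc m)) \<le> C s \<omega> {j, Suc j}" by (auto simp: less_imp_le)
      then show "\<exists>u\<ge>s. n < X u \<omega>" using elim(1) by (meson not_less)
    qed
  qed
qed

section \<open>Returns to 0 and recurrence\<close>

lemma AE_visits_zero:
  assumes unbounded: "\<And>B. \<exists>N. B < potential c N"
  shows "AE \<omega> in M. \<forall>s. \<exists>u\<ge>s. X u \<omega> = 0"
proof -
  have null: "AE \<omega> in M. \<not> (potential (C s \<omega>) (X s \<omega>) \<le> real k \<and> (\<forall>u\<ge>s. X u \<omega> \<noteq> 0))" for s k :: nat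
  proof -
    define V where "V = {\<omega>\<in>space M. potential (C s \<omega>) (X s \<omega>) \<le> real k \<and> (\<forall>u\<ge>s. X u \<omega> \<noteq> 0)}"
    define W where "W N t = {\<omega>\<in>space M. potential (C s \<omega>) (X s \<omega>) \<le> real k \<and>
      (\<exists>u\<in>{s..t}. N \<le> X u \<omega> \<and> (\<forall>r\<in>{s..u}. X r \<omega> \<noteq> 0))}" for N t
    have [measurable]: "V \<in> sets M" "W N t \<in> sets M" for N t
      unfolding V_def W_def by measurable
    \<comment> \<open>A path that avoids 0 is still unbounded, so it reaches \<open>N\<close> by
      some finite horizon. The events \<open>W\<close> increase with the horizon, and
      \<open>hitting_bound\<close> is uniform in it.\<close>
    have "potential c N * measure M V \<le> real k" for N
    proof -
      have "emeasure M V \<le> emeasure M (\<Union>m. W N (s + m))"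
      proof (rule emeasure_mono_AE, use AE_unbounded in eventually_elim)
        case (elim \<omega>)
        show ?case
        proof
          assume V: "\<omega> \<in> V"
          obtain u where u: "s \<le> u" "N < X u \<omega>" using elim by blast
          then have "\<omega> \<in> W N (s + (u - s))"
            using V by (auto simp: V_def W_def intro!: bexI[of _ u])
          then show "\<omega> \<in> (\<Union>m. W N (s + m))" by blast
        qed
      qed measurable
      also have "\<dots> = (SUP m. emeasure M (W N (s + m)))"
        by (intro SUP_emeasure_incseq[symmetric]) (fastforce simp: incseq_def W_def)+
      finally have "ennreal (potential c N) * emeasure M V
          \<le> ennreal (potential c N) * (SUP m. emeasure M (W N (s + m)))"
        by (rule mult_left_mono) simp
      also have "\<dots> = (SUP m. ennreal (potential c N) * emeasure M (W N (s + m)))"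
        by (rule SUP_mult_left_ennreal)
      also have "\<dots> \<le> ennreal (real k)"
        unfolding W_def by (intro SUP_least hitting_bound) auto
      finally have "ennreal (potential c N * measure M V) \<le> ennreal (real k)"
        using potential_nonneg[of c N, OF bound_pos] by (simp add: emeasure_eq_measure ennreal_mult)
      then show ?thesis by (subst (asm) ennreal_le_iff) auto
    qed
    then have "measure M V = 0"
    proof (rule_tac ccontr)
      assume bound: "\<And>N. potential c N * measure M V \<le> real k" and "measure M V \<noteq> 0"
      then have pos: "0 < measure M V" by (simp add: zero_less_measure_iff)
      obtain N where "real k / measure M V < potential c N" using unbounded by blast
      with pos bound[of N] show False by (simp add: field_simps)
    qed
    then have "V \<in> null_sets M"
      by (simp add: null_sets_def emeasure_eq_measure)
    from AE_not_in[OF this] AE_space show ?thesis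
      by eventually_elim (auto simp: V_def)
  qed
  \<comment> \<open>Every starting potential lies below some natural number \<open>k\<close>, so
    countably many cutoffs suffice.\<close>
  have "AE \<omega> in M. \<forall>s k::nat. \<not> (potential (C s \<omega>) (X s \<omega>) \<le> real k \<and> (\<forall>u\<ge>s. X u \<omega> \<noteq> 0))"
    by (intro AE_all_countable[THEN iffD2] allI null)
  then show ?thesis
    by eventually_elim (meson real_arch_simple)
qed

text \<open>After any time the walk visits 0 and later exceeds \<open>v\<close>; by unit steps it
  cannot skip \<open>v\<close> in between. Integers make the discrete intermediate value theorem
  treat steps down like steps up.\<close>

lemma AE_recurrent:
  assumes "\<And>B. \<exists>N. B < potential c N"
  shows "recurrent_walk M X"
  unfolding recurrent_walk_def
  using AE_visits_zero[OF assms] AE_unbounded AE_nearest_neighbour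
proof eventually_elim
  case (elim \<omega>)
  have "\<exists>t\<ge>s. X t \<omega> = v" for v s
  proof -
    obtain u where u: "s \<le> u" "X u \<omega> = 0" using elim(1) by blast
    obtain w where w: "u \<le> w" "v < X w \<omega>" using elim(2) by blast
    have "\<exists>t. u \<le> t \<and> t \<le> w \<and> int (X t \<omega>) = int v"
    proof (rule nat_intermed_int_val[where f="\<lambda>t. int (X t \<omega>)"])
      show "\<forall>i. u \<le> i \<and> i < w \<longrightarrow> \<bar>int (X (Suc i) \<omega>) - int (X i \<omega>)\<bar> \<le> 1"
      proof (intro allI impI)
        fix i
        from elim(3) have "X (Suc i) \<omega> = Suc (X i \<omega>) \<or> X i \<omega> = Suc (X (Suc i) \<omega>)" by blast
        then show "\<bar>int (X (Suc i) \<omega>) - int (X i \<omega>)\<bar> \<le> 1" by auto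
      qed
    qed (use u w in auto)
    then show ?thesis using u(1) by (meson of_nat_eq_iff order_trans)
  qed
  then show ?case by (simp add: infinite_nat_iff_unbounded_le)
qed

section \<open>Divergent resistance from recurrence of the bounding graph\<close>

text \<open>
  If the potential were bounded, its expectation until the walk from \<open>1\<close> hits \<open>0\<close> would be constant
  and yet vanish in the limit.
\<close>

lemma potential_unbounded:
  assumes const: "\<And>t \<omega>. C t \<omega> = c" and start: "AE \<omega> in M. X 0 \<omega> = 1"
    and rec: "recurrent_walk M X"
  shows "\<exists>N. B < potential c N"
proof (rule ccontr)
  assume "\<not> (\<exists>N. B < potential c N)"
  then have B: "potential c N \<le> B" for N by (simp add: not_less)
  then have "0 \<le> B" using potential_0 by metis
  define D where "D t = {\<omega>\<in>space M. \<forall>u\<in>{0..t}. X u \<omega> \<noteq> 0}" for t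
  have D_hist: "D t \<in> sets (hist t)" for t
    using pred_walk_history[of 0 t "\<lambda>x. x \<noteq> 0"] by (simp add: D_def pred_def)
  have [measurable]: "D t \<in> sets M" for t
    unfolding D_def by measurable
  have "(\<integral>\<^sup>+ \<omega>. indicator (D t) \<omega> * ennreal (potential c (X t \<omega>)) \<partial>M) = ennreal (potential c 1)" for t
  proof (induction t)
    case 0
    have "(\<integral>\<^sup>+ \<omega>. indicator (D 0) \<omega> * ennreal (potential c (X 0 \<omega>)) \<partial>M) = (\<integral>\<^sup>+ \<omega>. ennreal (potential c 1) \<partial>M)"
      by (rule nn_integral_cong_AE, use start AE_space in eventually_elim) (auto simp: D_def)
    then show ?case by (simp add: emeasure_space_1)
  next
    case (Suc t)
    have "(\<integral>\<^sup>+ \<omega>. indicator (D (Suc t)) \<omega> * ennreal (potential c (X (Suc t) \<omega>)) \<partial>M) =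
      (\<integral>\<^sup>+ \<omega>. indicator (D t) \<omega> * ennreal (potential (C t \<omega>) (X (Suc t) \<omega>)) \<partial>M)"
      \<comment> \<open>Leaving \<open>D t\<close> in this step means landing on 0, where the
        potential vanishes, so both indicators give the same integrand.\<close>
      by (intro nn_integral_cong) (auto simp: D_def const indicator_def atLeastAtMostSuc_conv)
    also have "\<dots> = (\<integral>\<^sup>+ \<omega>. indicator (D t) \<omega> * ennreal (potential (C t \<omega>) (X t \<omega>)) \<partial>M)"
      by (intro nn_integral_potential_next D_hist) (auto simp: D_def)
    finally show ?case using Suc by (simp add: const)
  qed
  moreover have "(\<integral>\<^sup>+ \<omega>. indicator (D t) \<omega> * ennreal (potential c (X t \<omega>)) \<partial>M) \<le> ennreal (B * measure M (D t))" for t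
  proof -
    have "(\<integral>\<^sup>+ \<omega>. indicator (D t) \<omega> * ennreal (potential c (X t \<omega>)) \<partial>M) \<le> (\<integral>\<^sup>+ \<omega>. ennreal B * indicator (D t) \<omega> \<partial>M)"
      using B by (intro nn_integral_mono) (auto simp: indicator_def intro: ennreal_leI)
    also have "\<dots> = ennreal B * emeasure M (D t)"
      by (intro nn_integral_cmult_indicator) measurable
    finally show ?thesis using \<open>0 \<le> B\<close> by (simp add: emeasure_eq_measure ennreal_mult)
  qed
  ultimately have "ennreal (potential c 1) \<le> ennreal (B * measure M (D t))" for t by metis
  then have le: "potential c 1 \<le> B * measure M (D t)" for t
    using \<open>0 \<le> B\<close> by (subst (asm) ennreal_le_iff) auto
  \<comment> \<open>The \<open>D t\<close> decrease to the event of never visiting 0, which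
    recurrence makes null, while \<open>le\<close> keeps \<open>B\<close> times their probability at
    least the positive \<open>potential c 1\<close>.\<close>
  have "(\<lambda>t. measure M (D t)) \<longlonglongrightarrow> measure M (\<Inter>t. D t)"
    by (intro finite_Lim_measure_decseq) (auto simp: decseq_def D_def)
  moreover have "measure M (\<Inter>t. D t) = 0"
  proof -
    have "AE \<omega> in M. \<omega> \<notin> (\<Inter>t. D t)"
      using rec unfolding recurrent_walk_def
    proof eventually_elim
      case (elim \<omega>)
      then have "{t. X t \<omega> = 0} \<noteq> {}" by (metis finite.emptyI)
      then obtain t where "X t \<omega> = 0" by blast
      then have "\<omega> \<notin> D t" by (auto simp: D_def)
      then show ?case by blast
    qed
    then show ?thesis by (simp add: prob_eq_0)
  qed
  ultimately have "(\<lambda>t. B * measure M (D t)) \<longlonglongrightarrow> B * 0"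
    by (intro tendsto_mult_left) simp
  then have "potential c 1 \<le> B * 0"
    using le by (intro LIMSEQ_le_const) auto
  then show False using bound_pos[of 0] by (simp add: potential_def)
qed

end

theorem theorem4p1:
  fixes M :: "'a measure"
    and X :: "nat \<Rightarrow> 'a \<Rightarrow> nat"
    and C :: "nat \<Rightarrow> 'a \<Rightarrow> nat set \<Rightarrow> real"
    and Cinf :: "nat set \<Rightarrow> real"
  assumes "rwce M nat_edges X C"
    and "proper M nat_edges C"
    and "monotone_increasing M nat_edges C"
    and "connected_weighted_graph nat_edges Cinf"
    and "recurrent_weighted_graph nat_edges Cinf"
    and "bounded_above_by M nat_edges C Cinf"
  shows "recurrent_walk M X"
proof -
  interpret bounded_rwce M X C Cinf
    using assms by (auto simp: bounded_rwce_def bounded_rwce_axioms_def nat_rwce_def)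
  \<comment> \<open>The start is 1 because the argument for divergence needs a positive initial
    potential.\<close>
  obtain P where "weighted_walk_law nat_edges Cinf 1 P" and rec: "recurrent_walk P (\<lambda>t \<omega>. \<omega> t)"
    using assms(5) unfolding recurrent_weighted_graph_def by blast
  then have P: "rwce P nat_edges (\<lambda>t \<omega>. \<omega> t) (\<lambda>t \<omega>. Cinf)" and start: "AE \<omega> in P. \<omega> 0 = 1"
    unfolding weighted_walk_law_def by auto
  \<comment> \<open>The walk with constant conductances \<open>Cinf\<close> is monotone and bounded
    by \<open>Cinf\<close> itself, so the martingale identity holds for it too.\<close>
  interpret weighted: bounded_rwce P "\<lambda>t \<omega>. \<omega> t" "\<lambda>t \<omega>. Cinf" Cinf
    using P bound_pos
    by (auto simp: bounded_rwce_def bounded_rwce_axioms_def nat_rwce_def proper_def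
        monotone_increasing_def bounded_above_by_def nat_edges_def)
  show ?thesis
    by (rule AE_recurrent) (rule weighted.potential_unbounded[OF refl start rec])
qed

end
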